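(* Let $G=(V,E)$ be a finite simple undirected graph. Then the total number of binary variables used by the QUBO formulation of the Domination Problem on $G$ described in the context (vertex variables together with all slack variables) is at most $|V|+2|E|$.
   Context: For a vertex $i\in V$, $N[i]$ denotes the closed neighborhood of $i$ ($i$ together with its neighbors). For an integer $m\ge 1$, $bl_m$ denotes the length of the binary representation of $m$, i.e. $bl_m=\lfloor\log_2 m\rfloor+1$. The Domination Problem (DP) on $G$ is the 0-1 program: minimize $\sum_{i\in V}X_i$ subject to $\sum_{j\in N[i]}X_j\ge 1$ for all $i\in V$, with $X_i\in\{0,1\}$ (where $X_i=1$ means that $i$ is in the dominating set $D$). The QUBO (quadratic unconstrained binary optimization) formulation is obtained as follows. There is one binary variable $X_i$ for each $i\in V$. With a penalty coefficient $P$, for each vertex $i\in V$ the constraint $\sum_{j\in N[i]}X_j\ge 1$, with $n=|N[i]|$, is replaced by a quadratic penalty added to the objective $\sum_{i\in V} X_i$: - if $n=1$, with $N[i]=\{a\}$: the penalty $P(X_a-1)^2$, with no additional variables; - if $n=2$, with $N[i]=\{a,b\}$: the penalty $P(1-X_a-X_b+X_aX_b)$, with no additional variables; - if $n\ge 3$: the penalty $P\bigl(\sum_{j\in N[i]}X_j-S-1\bigr)^2$, where $$S=\sum_{t=1}^{bl_{n-1}-1}2^{t-1}X'_t+\Bigl(n-1-\sum_{t=1}^{bl_{n-1}-1}2^{t-1}\Bigr)X'_{bl_{n-1}}$$ and $X'_1,\dots,X'_{bl_{n-1}}\in\{0,1\}$ are $bl_{n-1}$ new binary slack variables, introduced separately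 for each such vertex $i$. *)

theory Defs
  imports Complex_Main
begin

definition simple_graph :: "'a set \<Rightarrow> 'a set set \<Rightarrow> bool" where
  "simple_graph V E \<longleftrightarrow> finite V \<and> (\<forall>e\<in>E. e \<subseteq> V \<and> card e = 2)"

definition closed_nbhd :: "'a set \<Rightarrow> 'a set set \<Rightarrow> 'a \<Rightarrow> 'a set" where
  "closed_nbhd V E i = insert i {j \<in> V. {i, j} \<in> E}"

text \<open>Only meaningful for \<open>m \<ge> 1\<close>, which is the only way it is used below.\<close>

definition bl :: "nat \<Rightarrow> nat" where
  "bl m = nat (\<lfloor>log 2 (real m)\<rfloor> + 1)"

text \<open>
  \<open>Vtx i\<close> stands for \<open>X\<^sub>i\<close>, and \<open>Slack i t\<close> for the variable \<open>X'\<^sub>t\<close> introduced for the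
  constraint of vertex \<open>i\<close>; the index \<open>i\<close> keeps slack variables of different vertices apart.
\<close>

datatype 'a qvar = Vtx 'a | Slack 'a nat

text \<open>
  A QUBO instance: its variables, and the objective as a polynomial function of an
  assignment, to be minimized over assignments of values in \<open>{0, 1}\<close> to the variables.
\<close>

record 'v qubo =
  qubo_vars :: "'v set"
  qubo_obj :: "('v \<Rightarrow> real) \<Rightarrow> real"

definition slack_vars :: "'a set \<Rightarrow> 'a set set \<Rightarrow> 'a \<Rightarrow> 'a qvar set" where
  "slack_vars V E i =
    (let n = card (closed_nbhd V E i)
     in if n \<ge> 3 then Slack i ` {1..bl (n - 1)} else {})"

definition slack_sum :: "nat \<Rightarrow> 'a \<Rightarrow> ('a qvar \<Rightarrow> real) \<Rightarrow> real" where
  "slack_sum n i x =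
    (\<Sum>t = 1..bl (n - 1) - 1. 2 ^ (t - 1) * x (Slack i t))
    + (real n - 1 - (\<Sum>t = 1..bl (n - 1) - 1. 2 ^ (t - 1))) * x (Slack i (bl (n - 1)))"

text \<open>
  For \<open>N = {a}\<close> the first case is \<open>(X\<^sub>a - 1)\<^sup>2\<close>, and for \<open>N = {a, b}\<close>
  with \<open>a \<noteq> b\<close> the second is \<open>1 - X\<^sub>a - X\<^sub>b + X\<^sub>a X\<^sub>b\<close>.
\<close>

definition penalty :: "'a set \<Rightarrow> 'a set set \<Rightarrow> 'a \<Rightarrow> ('a qvar \<Rightarrow> real) \<Rightarrow> real" where
  "penalty V E i x =
    (let N = closed_nbhd V E i; n = card N
     in if n = 1 then ((\<Sum>j\<in>N. x (Vtx j)) - 1)\<^sup>2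
        else if n = 2 then 1 - (\<Sum>j\<in>N. x (Vtx j)) + (\<Prod>j\<in>N. x (Vtx j))
        else ((\<Sum>j\<in>N. x (Vtx j)) - slack_sum n i x - 1)\<^sup>2)"

definition domination_qubo :: "'a set \<Rightarrow> 'a set set \<Rightarrow> real \<Rightarrow> 'a qvar qubo" where
  "domination_qubo V E P =
    \<lparr>qubo_vars = Vtx ` V \<union> (\<Union>i\<in>V. slack_vars V E i),
     qubo_obj = (\<lambda>x. (\<Sum>i\<in>V. x (Vtx i)) + (\<Sum>i\<in>V. P * penalty V E i x))\<rparr>"

lemma finite_domination_qubo_vars:
  assumes "simple_graph V E"
  shows "finite (qubo_vars (domination_qubo V E P))"
  using assms
  by (auto simp: simple_graph_def domination_qubo_def slack_vars_def Let_def)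

text \<open>The objective mentions no variable outside the declared ones.\<close>

lemma domination_qubo_obj_cong:
  assumes G: "simple_graph V E"
    and eq: "\<And>v. v \<in> qubo_vars (domination_qubo V E P) \<Longrightarrow> x v = y v"
  shows "qubo_obj (domination_qubo V E P) x = qubo_obj (domination_qubo V E P) y"
proof -
  have X: "x (Vtx i) = y (Vtx i)" if "i \<in> V" for i
    using eq that by (auto simp: domination_qubo_def)
  have "penalty V E i x = penalty V E i y" if i: "i \<in> V" for i
  proof -
    let ?N = "closed_nbhd V E i"
    let ?n = "card ?N"
    have N: "?N \<subseteq> V" using i by (auto simp: closed_nbhd_def)
    have "finite ?N" using G N finite_subset by (auto simp: simple_graph_def)
    then have pos: "?n \<noteq> 0" by (auto simp: closed_nbhd_def)
    have s: "(\<Sum>j\<in>?N. x (Vtx j)) = (\<Sum>j\<in>?N. y (Vtx j))"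
      and p: "(\<Prod>j\<in>?N. x (Vtx j)) = (\<Prod>j\<in>?N. y (Vtx j))"
      using N X by (auto intro!: sum.cong prod.cong)
    have "slack_sum ?n i x = slack_sum ?n i y" if n: "?n \<ge> 3"
    proof -
      have S: "x (Slack i t) = y (Slack i t)" if "t \<in> {1..bl (?n - 1)}" for t
      proof (rule eq)
        have "Slack i t \<in> slack_vars V E i"
          using n that by (simp add: slack_vars_def Let_def)
        then show "Slack i t \<in> qubo_vars (domination_qubo V E P)"
          using i by (auto simp: domination_qubo_def)
      qed
      have "0 \<le> log 2 (real (?n - 1))" using n by simp
      then have b: "bl (?n - 1) \<ge> 1" unfolding bl_def by linarith
      have "(\<Sum>t = 1..bl (?n - 1) - 1. 2 ^ (t - 1) * x (Slack i t)) =
            (\<Sum>t = 1..bl (?n - 1) - 1. 2 ^ (t - 1) * y (Slack i t))"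
        by (intro sum.cong refl) (use S in auto)
      moreover have "x (Slack i (bl (?n - 1))) = y (Slack i (bl (?n - 1)))"
        using S b by simp
      ultimately show ?thesis unfolding slack_sum_def by simp
    qed
    moreover have "?n = 1 \<or> ?n = 2 \<or> ?n \<ge> 3" using pos by linarith
    ultimately show ?thesis
      unfolding penalty_def Let_def s p by auto
  qed
  then show ?thesis using X by (simp add: domination_qubo_def)
qed

end

theory Submission imports Defs begin

text \<open>
  Since \<open>m < 2 ^ m\<close>, the binary length of \<open>m\<close> is at most \<open>m\<close>; so the constraint of a vertex
  \<open>i\<close> needs at most \<open>|N[i]| - 1\<close> slack variables, which is the degree of \<open>i\<close>. The degrees sum
  to \<open>2 |E|\<close>.
\<close>

lemma bl_le:
  assumes "m \<ge> 1"
  shows "bl m \<le> m"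
proof -
  \<comment> \<open>Strictness matters: it keeps the floor of the logarithm at most
    \<open>m - 1\<close>, which absorbs the \<open>+ 1\<close> in \<open>bl\<close>.\<close>
  have "log 2 (real m) < real m"
    using assms by (simp add: log_less_iff powr_realpow of_nat_less_two_power)
  then show ?thesis
    unfolding bl_def by linarith
qed

lemma finite_edges: "simple_graph V E \<Longrightarrow> finite E"
  unfolding simple_graph_def by (meson Pow_iff finite_Pow_iff finite_subset subsetI)

text \<open>Distinct neighbours \<open>j\<close> of \<open>i\<close> give distinct incident edges
  \<open>{i, j}\<close>; the \<open>Suc\<close> accounts for \<open>i\<close> itself.\<close>

lemma card_closed_nbhd_le:
  assumes "simple_graph V E"
  shows "card (closed_nbhd V E i) \<le> Suc (card {e \<in> E. i \<in> e})"
proof -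
  have "card {j \<in> V. {i, j} \<in> E} \<le> card {e \<in> E. i \<in> e}"
  proof (rule card_inj_on_le)
    show "inj_on (\<lambda>j. {i, j}) {j \<in> V. {i, j} \<in> E}"
      by (auto simp: inj_on_def doubleton_eq_iff)
  qed (use finite_edges[OF assms] in auto)
  then show ?thesis
    using assms by (auto simp: closed_nbhd_def simple_graph_def card_insert_if)
qed

lemma card_slack_vars_le:
  assumes "simple_graph V E"
  shows "card (slack_vars V E i) \<le> card {e \<in> E. i \<in> e}"
proof (cases "card (closed_nbhd V E i) \<ge> 3")
  case True
  then have "card (slack_vars V E i) \<le> bl (card (closed_nbhd V E i) - 1)"
    using card_image_le[of "{1..bl (card (closed_nbhd V E i) - 1)}" "Slack i"]
    by (simp add: slack_vars_def Let_def)
  also have "\<dots> \<le> card (closed_nbhd V E i) - 1"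
    using True by (intro bl_le) simp
  also have "\<dots> \<le> card {e \<in> E. i \<in> e}"
    using card_closed_nbhd_le[OF assms, of i] by simp
  finally show ?thesis .
qed (simp add: slack_vars_def)

text \<open>Double counting of the incident pairs \<open>(i, e)\<close>: grouped by edge instead of
  by vertex, each edge contributes its two endpoints, both of which lie in \<open>V\<close>.\<close>

lemma sum_card_incident_edges:
  assumes "simple_graph V E"
  shows "(\<Sum>i\<in>V. card {e \<in> E. i \<in> e}) = 2 * card E"
proof (rule sum_multicount)
  show "\<forall>e\<in>E. card {i \<in> V. i \<in> e} = 2"
  proof
    fix e assume "e \<in> E"
    then have "{i \<in> V. i \<in> e} = e" "card e = 2"
      using assms by (auto simp: simple_graph_def)
    then show "card {i \<in> V. i \<in> e} = 2" by simp
  qed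
qed (use assms finite_edges in \<open>auto simp: simple_graph_def\<close>)

theorem theorem4:
  fixes V :: "'a set" and E :: "'a set set" and P :: real
  assumes "simple_graph V E"
  shows "card (qubo_vars (domination_qubo V E P)) \<le> card V + 2 * card E"
proof -
  have fin: "finite V"
    using assms by (simp add: simple_graph_def)
  \<comment> \<open>Only an upper bound is claimed, so subadditivity of \<open>card\<close>
    suffices, here and for the union over \<open>V\<close> in the next step.\<close>
  have "card (qubo_vars (domination_qubo V E P))
      \<le> card (Vtx ` V) + card (\<Union>i\<in>V. slack_vars V E i)"
    by (simp add: domination_qubo_def card_Un_le)
  also have "\<dots> \<le> card V + (\<Sum>i\<in>V. card (slack_vars V E i))"
    by (intro add_mono card_image_le card_UN_le fin)
  also have "\<dots> \<le> card V + (\<Sum>i\<in>V. card {e \<in> E. i \<in> e})"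
    by (intro add_left_mono sum_mono card_slack_vars_le assms)
  finally show ?thesis
    by (simp add: sum_card_incident_edges[OF assms])
qed

end
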